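(* Let $D$ be a commutative ring and let $R \subseteq D$ be a subring with $\mathsf T(R)=\mathsf T(D)$ such that $$D = RD^{\times}, \qquad D^{\times}\cap R = R^{\times}, \qquad\text{and}\qquad (R:D) \in v\text{-}\max(R).$$ (1) If $D$ is a Krull ring, then $D^\bullet$ is a Krull monoid, the inclusion $R^\bullet\hookrightarrow D^\bullet$ is a transfer homomorphism, and $\mathcal L(R)=\mathcal L(D)$. (2) If $D$ is a C-ring, then $D^\bullet$ is a C-monoid, the inclusion $R^\bullet\hookrightarrow D^\bullet$ is a transfer homomorphism, and $\mathcal L(R)=\mathcal L(D)$.
   Context: Rings are non-zero, commutative, with unit element. For a ring $R$: $\mathsf T(R)$ is its total quotient ring, $R^\times$ its unit group, $\mathsf Z(R)$ its set of zero-divisors (with $0\in \mathsf Z(R)$), and $R^\bullet=R\setminus \mathsf Z(R)$ the monoid of regular elements. For a subring $R\subseteq D$, $\mathsf T(R)=\mathsf T(D)$ means that regular elements of $R$ are regular in $D$ and the induced inclusion $\mathsf T(R)\subseteq\mathsf T(D)$ is an equality. For $X,Y\subseteq \mathsf T(R)$ let $(X:Y)=\{a\in \mathsf T(R)\mid aY\subseteq X\}$. For an $R$-submodule $I$ of $\mathsf T(R)$ let $I^{-1}=(R:I)$ and $I_v=(I^{-1})^{-1}$; $I$ is a $v$-ideal (divisorial) if $I=I_v$. $v\text{-}\max(R)$ is the set of maximal elements, with respect to inclusion, among the $v$-ideals $I\subsetneq R$ (not required to be regular). An ideal is regular if it contains a regular element. Krull rings: $x\in\mathsf T(R)$ is almost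 integral over $R$ if there is $c\in R^\bullet$ with $cx^n\in R$ for all $n\in\mathbb N$; $R$ is completely integrally closed if every such $x$ lies in $R$. $R$ is a Mori ring if it satisfies the ascending chain condition on regular divisorial ideals of $R$. $R$ is a Krull ring if it is a completely integrally closed Mori ring. It is a known fact that this is equivalent to: there is a family $(\mathsf v_\alpha)_{\alpha}$ of rank-one discrete valuations on $\mathsf T(R)$ (surjective maps $\mathsf T(R)\to\mathbb Z\cup\{\infty\}$ with $\mathsf v(xy)=\mathsf v(x)+\mathsf v(y)$, $\mathsf v(x+y)\ge\min\{\mathsf v(x),\mathsf v(y)\}$, $\mathsf v(1)=0$, $\mathsf v(0)=\infty$) such that, with $V_\alpha=\{\mathsf v_\alpha\ge 0\}$ and $P_\alpha=\{\mathsf v_\alpha>0\}$, one has $R=\bigcap_\alpha V_\alpha$, every $P_\alpha$ is regular, and for each regular $x\in\mathsf T(R)$, $\mathsf v_\alpha(x)=0$ for all but finitely many $\alpha$. Monoids are commutative, cancellative semigroups with identity; $H^\times$ is the unit group and $\mathbf q(H)$ the quotient group of $H$; $a\simeq b$ means $a=ub$ with $u\in H^\times$. For $X,Y\subseteq\mathbf q(H)$ let $(X:Y)=\{a\in\mathbf q(H)\mid aY\subseteq X\}$ and $X_v=(H:(H:X))$; $X\subseteq H$ is a $v$-ideal of $H$ if $X_v=X$. $H$ is Mori if it satisfies the ascending chain condition on $v$-ideals; $H$ is completely integrally closed if every $x\in\mathbf q(H)$ for which there is $c\in H$ with $cx^n\in H$ for all $n\in\mathbb N$ lies in $H$; $H$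 is a Krull monoid if it is Mori and completely integrally closed. C-monoids: an element $a\in H\setminus H^\times$ is an atom if $a=uv$ with $u,v\in H$ implies $u\in H^\times$ or $v\in H^\times$; $H$ is atomic if every non-unit is a finite product of atoms, and factorial if moreover every atom is a prime element. Let $F$ be a factorial monoid and $H\subseteq F$ a submonoid. Elements $y,y'\in F$ are $H$-equivalent if for all $x\in F$: $xy\in H\iff xy'\in H$; this is a congruence relation, with classes $[y]_H^F$. The reduced class semigroup is $\mathcal C^*(H,F)=\{[y]_H^F\mid y\in (F\setminus F^\times)\cup\{1\}\}$. A monoid $H$ is a C-monoid if it is a submonoid of a factorial monoid $F$ such that $H\cap F^\times=H^\times$ and $\mathcal C^*(H,F)$ is finite. A ring $R$ is a C-ring if $R^\bullet$ is a C-monoid. A monoid homomorphism $\theta:H\to B$ is a transfer homomorphism if (T1) $B=\theta(H)B^\times$ and $\theta^{-1}(B^\times)=H^\times$; and (T2) whenever $u\in H$, $b,c\in B$ and $\theta(u)=bc$, there exist $v,w\in H$ with $u=vw$, $\theta(v)\simeq b$ and $\theta(w)\simeq c$. For a non-unit $a\in H$, $\mathsf L_H(a)=\{k\in\mathbb N\mid a\text{ is a product of }k\text{ atoms of }H\}$, and $\mathsf L_H(a)=\{0\}$ for $a\in H^\times$; for a ring $R$, $\mathcal L(R)=\{\mathsf L_{R^\bullet}(a)\mid a\in R^\bullet\}$. *)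

theory Defs
  imports "HOL-Algebra.Algebra"
begin

text \<open>
  Conventions. All rings occurring below are subrings of one ring \<open>T\<close>, the common total
  quotient ring. A subring is a carrier set \<open>S\<close>, and the ring itself is
  \<open>T\<lparr>carrier := S\<rparr>\<close>. Likewise the quotient group of a monoid is an ambient group
  containing the monoid. Both are determined up to isomorphism by the predicates
  \<open>total_quotient_ring\<close> and \<open>quotient_group\<close>.
\<close>

section \<open>Regular elements and total quotient rings\<close>

definition regular_elements :: "('a, 'b) ring_scheme \<Rightarrow> 'a set" where
  "regular_elements A =
     {a \<in> carrier A. \<forall>b \<in> carrier A. a \<otimes>\<^bsub>A\<^esub> b = \<zero>\<^bsub>A\<^esub> \<longrightarrow> b = \<zero>\<^bsub>A\<^esub>}"

definition regular_monoid :: "('a, 'b) ring_scheme \<Rightarrow> 'a monoid" where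
  "regular_monoid A =
     \<lparr>carrier = regular_elements A, monoid.mult = monoid.mult A, one = one A\<rparr>"

text \<open>
  \<open>T\<close> is a total quotient ring of its subring \<open>S\<close>. If this holds for \<open>S = R\<close> and for
  \<open>S = D\<close> with \<open>R \<subseteq> D\<close>, then regular elements of \<open>R\<close> are units of \<open>T\<close> and hence regular
  in \<open>D\<close>, and the induced map from the total quotient ring of \<open>R\<close> to that of \<open>D\<close> is onto;
  this is how an equality of total quotient rings is expressed.
\<close>
definition total_quotient_ring :: "('a, 'b) ring_scheme \<Rightarrow> 'a set \<Rightarrow> bool" where
  "total_quotient_ring T S \<longleftrightarrow>
     cring T \<and> \<one>\<^bsub>T\<^esub> \<noteq> \<zero>\<^bsub>T\<^esub> \<and> subring S T \<and>
     regular_elements (T\<lparr>carrier := S\<rparr>) \<subseteq> Units T \<and>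
     (\<forall>x \<in> carrier T. \<exists>a \<in> S. \<exists>s \<in> regular_elements (T\<lparr>carrier := S\<rparr>).
        x = a \<otimes>\<^bsub>T\<^esub> inv\<^bsub>T\<^esub> s)"


section \<open>Divisorial ideals and Krull rings\<close>

text \<open>
  The quotient \<open>(U : V)\<close>, used both in a total quotient ring and in a quotient group.
\<close>
definition colon :: "('a, 'b) monoid_scheme \<Rightarrow> 'a set \<Rightarrow> 'a set \<Rightarrow> 'a set" where
  "colon Q U V = {a \<in> carrier Q. \<forall>y \<in> V. a \<otimes>\<^bsub>Q\<^esub> y \<in> U}"

definition v_closure :: "('a, 'b) monoid_scheme \<Rightarrow> 'a set \<Rightarrow> 'a set \<Rightarrow> 'a set" where
  "v_closure Q S U = colon Q S (colon Q S U)"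

definition divisorial_ideal :: "('a, 'b) ring_scheme \<Rightarrow> 'a set \<Rightarrow> 'a set \<Rightarrow> bool" where
  "divisorial_ideal T S I \<longleftrightarrow> ideal I (T\<lparr>carrier := S\<rparr>) \<and> v_closure T S I = I"

definition regular_ideal :: "('a, 'b) ring_scheme \<Rightarrow> 'a set \<Rightarrow> 'a set \<Rightarrow> bool" where
  "regular_ideal T S I \<longleftrightarrow>
     ideal I (T\<lparr>carrier := S\<rparr>) \<and> I \<inter> regular_elements (T\<lparr>carrier := S\<rparr>) \<noteq> {}"

definition v_max :: "('a, 'b) ring_scheme \<Rightarrow> 'a set \<Rightarrow> 'a set set" where
  "v_max T S = {I. divisorial_ideal T S I \<and> I \<subset> S \<and>
     (\<forall>J. divisorial_ideal T S J \<and> J \<subset> S \<and> I \<subseteq> J \<longrightarrow> J = I)}"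

definition acc_on_sets :: "('a set \<Rightarrow> bool) \<Rightarrow> bool" where
  "acc_on_sets P \<longleftrightarrow>
     (\<forall>I :: nat \<Rightarrow> 'a set. (\<forall>n. P (I n)) \<and> (\<forall>n. I n \<subseteq> I (Suc n)) \<longrightarrow>
        (\<exists>n. \<forall>m \<ge> n. I m = I n))"

definition Mori_ring :: "('a, 'b) ring_scheme \<Rightarrow> 'a set \<Rightarrow> bool" where
  "Mori_ring T S \<longleftrightarrow> total_quotient_ring T S \<and>
     acc_on_sets (\<lambda>I. divisorial_ideal T S I \<and> regular_ideal T S I)"

definition almost_integral :: "('a, 'b) ring_scheme \<Rightarrow> 'a set \<Rightarrow> 'a \<Rightarrow> bool" where
  "almost_integral T S x \<longleftrightarrow> x \<in> carrier T \<and>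
     (\<exists>c \<in> regular_elements (T\<lparr>carrier := S\<rparr>). \<forall>n::nat. c \<otimes>\<^bsub>T\<^esub> x [^]\<^bsub>T\<^esub> n \<in> S)"

definition completely_integrally_closed_ring :: "('a, 'b) ring_scheme \<Rightarrow> 'a set \<Rightarrow> bool" where
  "completely_integrally_closed_ring T S \<longleftrightarrow> total_quotient_ring T S \<and>
     (\<forall>x. almost_integral T S x \<longrightarrow> x \<in> S)"

definition Krull_ring :: "('a, 'b) ring_scheme \<Rightarrow> 'a set \<Rightarrow> bool" where
  "Krull_ring T S \<longleftrightarrow> completely_integrally_closed_ring T S \<and> Mori_ring T S"


section \<open>Krull monoids\<close>

text \<open>
  \<open>Q\<close> is a quotient group of its submonoid \<open>H\<close>. The equation
  \<open>Q\<lparr>carrier := carrier H\<rparr> = H\<close> says that \<open>H\<close> carries the operation of \<open>Q\<close>.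
\<close>
definition quotient_group :: "'a monoid \<Rightarrow> 'a monoid \<Rightarrow> bool" where
  "quotient_group Q H \<longleftrightarrow>
     comm_group Q \<and> submonoid (carrier H) Q \<and> Q\<lparr>carrier := carrier H\<rparr> = H \<and>
     (\<forall>x \<in> carrier Q. \<exists>a \<in> carrier H. \<exists>b \<in> carrier H. x = a \<otimes>\<^bsub>Q\<^esub> inv\<^bsub>Q\<^esub> b)"

definition monoid_v_ideal :: "'a monoid \<Rightarrow> 'a monoid \<Rightarrow> 'a set \<Rightarrow> bool" where
  "monoid_v_ideal Q H U \<longleftrightarrow> U \<subseteq> carrier H \<and> v_closure Q (carrier H) U = U"

definition Mori_monoid :: "'a monoid \<Rightarrow> 'a monoid \<Rightarrow> bool" where
  "Mori_monoid Q H \<longleftrightarrow> quotient_group Q H \<and> acc_on_sets (monoid_v_ideal Q H)"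

definition completely_integrally_closed_monoid :: "'a monoid \<Rightarrow> 'a monoid \<Rightarrow> bool" where
  "completely_integrally_closed_monoid Q H \<longleftrightarrow> quotient_group Q H \<and>
     (\<forall>x \<in> carrier Q.
        (\<exists>c \<in> carrier H. \<forall>n::nat. c \<otimes>\<^bsub>Q\<^esub> x [^]\<^bsub>Q\<^esub> n \<in> carrier H) \<longrightarrow> x \<in> carrier H)"

definition Krull_monoid :: "'a monoid \<Rightarrow> 'a monoid \<Rightarrow> bool" where
  "Krull_monoid Q H \<longleftrightarrow> Mori_monoid Q H \<and> completely_integrally_closed_monoid Q H"


section \<open>C-monoids and C-rings\<close>

definition H_equivalent :: "('f, 'c) monoid_scheme \<Rightarrow> 'f set \<Rightarrow> 'f \<Rightarrow> 'f \<Rightarrow> bool" where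
  "H_equivalent F H y y' \<longleftrightarrow> y \<in> carrier F \<and> y' \<in> carrier F \<and>
     (\<forall>x \<in> carrier F. x \<otimes>\<^bsub>F\<^esub> y \<in> H \<longleftrightarrow> x \<otimes>\<^bsub>F\<^esub> y' \<in> H)"

definition reduced_class_semigroup :: "('f, 'c) monoid_scheme \<Rightarrow> 'f set \<Rightarrow> 'f set set" where
  "reduced_class_semigroup F H =
     (\<lambda>y. {y'. H_equivalent F H y y'}) ` ((carrier F - Units F) \<union> {\<one>\<^bsub>F\<^esub>})"

text \<open>
  Being a submonoid of a factorial monoid is meant up to isomorphism: \<open>H\<close> is identified with
  the submonoid \<open>H'\<close> of \<open>F\<close>. Since HOL cannot quantify over types inside a formula, the type
  of the elements of \<open>F\<close> is a parameter; "\<open>H\<close> is a C-monoid" means that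
  \<open>C_monoid TYPE('f) H\<close> holds for some type \<open>'f\<close>.
\<close>
definition C_monoid :: "'f itself \<Rightarrow> ('a, 'b) monoid_scheme \<Rightarrow> bool" where
  "C_monoid _ H \<longleftrightarrow> comm_monoid_cancel H \<and>
     (\<exists>(F :: 'f monoid) H'. factorial_monoid F \<and> submonoid H' F \<and> H \<cong> F\<lparr>carrier := H'\<rparr> \<and>
        H' \<inter> Units F = Units (F\<lparr>carrier := H'\<rparr>) \<and>
        finite (reduced_class_semigroup F H'))"

definition C_ring :: "'f itself \<Rightarrow> ('a, 'b) ring_scheme \<Rightarrow> bool" where
  "C_ring f A \<longleftrightarrow> C_monoid f (regular_monoid A)"


section \<open>Transfer homomorphisms and sets of lengths\<close>

definition transfer_homomorphism ::
    "('a, 'c) monoid_scheme \<Rightarrow> ('b, 'd) monoid_scheme \<Rightarrow> ('a \<Rightarrow> 'b) \<Rightarrow> bool" where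
  "transfer_homomorphism H B \<theta> \<longleftrightarrow>
     comm_monoid_cancel H \<and> comm_monoid_cancel B \<and>
     \<theta> \<in> hom H B \<and> \<theta> \<one>\<^bsub>H\<^esub> = \<one>\<^bsub>B\<^esub> \<and>
     carrier B = (\<theta> ` carrier H) <#>\<^bsub>B\<^esub> Units B \<and>
     {u \<in> carrier H. \<theta> u \<in> Units B} = Units H \<and>
     (\<forall>u \<in> carrier H. \<forall>b \<in> carrier B. \<forall>c \<in> carrier B. \<theta> u = b \<otimes>\<^bsub>B\<^esub> c \<longrightarrow>
        (\<exists>v \<in> carrier H. \<exists>w \<in> carrier H.
           u = v \<otimes>\<^bsub>H\<^esub> w \<and> \<theta> v \<sim>\<^bsub>B\<^esub> b \<and> \<theta> w \<sim>\<^bsub>B\<^esub> c))"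

text \<open>
  In a cancellative monoid \<open>irreducible\<close> elements are the atoms, and \<open>factors H fs a\<close> says
  that \<open>fs\<close> is a list of irreducible elements with product \<open>a\<close>.
\<close>
definition length_set :: "('a, 'b) monoid_scheme \<Rightarrow> 'a \<Rightarrow> nat set" where
  "length_set H a =
     (if a \<in> Units H then {0} else {length fs | fs. set fs \<subseteq> carrier H \<and> factors H fs a})"

definition system_of_length_sets :: "('a, 'b) ring_scheme \<Rightarrow> nat set set" where
  "system_of_length_sets A = length_set (regular_monoid A) ` regular_elements A"

end

theory Submission
  imports Defs
begin

text \<open>
  Let \<open>P = (R : D)\<close>. For \<open>u \<in> R\<close> regular with \<open>u = bc\<close> in \<open>D\<close>, write \<open>b = r\<epsilon>\<close> and \<open>c = s\<eta>\<close> with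
  \<open>r, s \<in> R\<close> and units \<open>\<epsilon>, \<eta>\<close> of \<open>D\<close>, so that \<open>u = rst\<close> with \<open>t = \<epsilon>\<eta>\<close>. If \<open>r \<in> P\<close>, then
  \<open>u = (rt)s\<close> is the required factorization. If \<open>r \<notin> P\<close>, maximality of \<open>P\<close> gives
  \<open>(P \<union> {r})\<^sub>v = R\<close>, hence \<open>(R : P \<union> {r}) = R\<close>. This quotient contains \<open>st\<close>, because \<open>str = u \<in> R\<close>
  and \<open>PD \<subseteq> R\<close>, and \<open>u = r(st)\<close> is the required factorization. Thus the inclusion is a
  transfer homomorphism, and these preserve sets of lengths.

  The regular elements of a Krull ring \<open>D\<close> form a Mori monoid because a \<open>v\<close>-ideal \<open>U\<close> of that
  monoid is recovered as the set of regular elements of the divisorial ideal generated by \<open>U\<close>.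
\<close>

section \<open>Transfer homomorphisms\<close>

lemma irreducible_mult_unit_cases:
  assumes "comm_monoid_cancel G" "irreducible G a" "b \<in> carrier G" "c \<in> carrier G"
    "a = b \<otimes>\<^bsub>G\<^esub> c"
  shows "b \<in> Units G \<or> c \<in> Units G"
proof -
  interpret comm_monoid_cancel G by fact
  show ?thesis
    using irreducible_prodE[OF _ assms(3,4)] assms(2,5) by metis
qed

text \<open>\<open>irreducible\<close> speaks of proper divisors, (T2) of factorizations; this is
  the bridge. If the cofactor \<open>c\<close> of a proper divisor \<open>b\<close> were a unit,
  \<open>b\<close> would be associated to \<open>a\<close> and hence not proper.\<close>

lemma irreducible_iff_mult:
  assumes "comm_monoid_cancel G" "a \<in> carrier G"
  shows "irreducible G a \<longleftrightarrow> a \<notin> Units G \<and>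
    (\<forall>b \<in> carrier G. \<forall>c \<in> carrier G. a = b \<otimes>\<^bsub>G\<^esub> c \<longrightarrow> b \<in> Units G \<or> c \<in> Units G)"
proof -
  interpret comm_monoid_cancel G by fact
  show ?thesis
  proof (intro iffI conjI ballI impI)
    assume "irreducible G a"
    then show "a \<notin> Units G" by (simp add: irreducible_def)
  next
    fix b c assume "irreducible G a" "b \<in> carrier G" "c \<in> carrier G" "a = b \<otimes>\<^bsub>G\<^esub> c"
    then show "b \<in> Units G \<or> c \<in> Units G"
      using irreducible_mult_unit_cases[OF assms(1)] by blast
  next
    assume *: "a \<notin> Units G \<and>
      (\<forall>b \<in> carrier G. \<forall>c \<in> carrier G. a = b \<otimes>\<^bsub>G\<^esub> c \<longrightarrow> b \<in> Units G \<or> c \<in> Units G)"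
    show "irreducible G a"
    proof (rule irreducibleI)
      show "a \<notin> Units G" using * by blast
    next
      fix b assume b: "b \<in> carrier G" "properfactor G b a"
      then obtain c where c: "c \<in> carrier G" "a = b \<otimes>\<^bsub>G\<^esub> c"
        unfolding properfactor_def factor_def by blast
      have "c \<notin> Units G"
      proof
        assume "c \<in> Units G"
        then have "a \<sim>\<^bsub>G\<^esub> b" using c b associatedI2 by metis
        then show False using b unfolding properfactor_def associated_def by blast
      qed
      then show "b \<in> Units G" using * b c by blast
    qed
  qed
qed

text \<open>A factorization of \<open>a\<close> is mapped by \<theta>, and one of
  \<open>\<theta> a\<close> is lifted by (T2) up to association. By (T1), and since association
  preserves units, unit factors correspond in both directions.\<close>

lemma transfer_homomorphism_irreducible_iff:
  assumes \<theta>: "transfer_homomorphism H B \<theta>" and a: "a \<in> carrier H"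
  shows "irreducible H a \<longleftrightarrow> irreducible B (\<theta> a)"
proof -
  interpret H: comm_monoid_cancel H using \<theta> by (simp add: transfer_homomorphism_def)
  interpret B: comm_monoid_cancel B using \<theta> by (simp add: transfer_homomorphism_def)
  have closed: "\<theta> x \<in> carrier B" if "x \<in> carrier H" for x
    using \<theta> that unfolding transfer_homomorphism_def hom_def by blast
  have mult: "\<theta> (x \<otimes>\<^bsub>H\<^esub> y) = \<theta> x \<otimes>\<^bsub>B\<^esub> \<theta> y" if "x \<in> carrier H" "y \<in> carrier H" for x y
    using \<theta> that unfolding transfer_homomorphism_def hom_def by blast
  have units: "\<theta> x \<in> Units B \<longleftrightarrow> x \<in> Units H" if "x \<in> carrier H" for x
    using \<theta> that unfolding transfer_homomorphism_def by blast
  have T2: "\<exists>v \<in> carrier H. \<exists>w \<in> carrier H. a = v \<otimes>\<^bsub>H\<^esub> w \<and> \<theta> v \<sim>\<^bsub>B\<^esub> b \<and> \<theta> w \<sim>\<^bsub>B\<^esub> c"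
    if "b \<in> carrier B" "c \<in> carrier B" "\<theta> a = b \<otimes>\<^bsub>B\<^esub> c" for b c
    using \<theta> that a unfolding transfer_homomorphism_def by blast
  have "(\<forall>b \<in> carrier H. \<forall>c \<in> carrier H. a = b \<otimes>\<^bsub>H\<^esub> c \<longrightarrow> b \<in> Units H \<or> c \<in> Units H) \<longleftrightarrow>
    (\<forall>b \<in> carrier B. \<forall>c \<in> carrier B. \<theta> a = b \<otimes>\<^bsub>B\<^esub> c \<longrightarrow> b \<in> Units B \<or> c \<in> Units B)"
    (is "?L \<longleftrightarrow> ?R")
  proof
    assume ?L
    show ?R
    proof (intro ballI impI)
      fix b c assume bc: "b \<in> carrier B" "c \<in> carrier B" "\<theta> a = b \<otimes>\<^bsub>B\<^esub> c"
      then obtain v w where vw: "v \<in> carrier H" "w \<in> carrier H" "a = v \<otimes>\<^bsub>H\<^esub> w"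
        "\<theta> v \<sim>\<^bsub>B\<^esub> b" "\<theta> w \<sim>\<^bsub>B\<^esub> c"
        using T2 by blast
      then have "\<theta> v \<in> Units B \<or> \<theta> w \<in> Units B" using \<open>?L\<close> units by blast
      then show "b \<in> Units B \<or> c \<in> Units B"
        using vw bc closed B.assoc_unit_r by blast
    qed
  next
    assume ?R
    then show ?L using mult closed units by metis
  qed
  then show ?thesis
    using irreducible_iff_mult[OF H.comm_monoid_cancel_axioms a]
      irreducible_iff_mult[OF B.comm_monoid_cancel_axioms closed[OF a]] units[OF a] by blast
qed

text \<open>Induction on \<open>bs\<close>, splitting off one atom at a time with (T2). The
  hypothesis on \<open>u\<close> asks only for association because (T2) determines
  \<open>\<theta> w\<close> only up to a unit. An empty \<open>bs\<close> would make
  \<open>u\<close> merely a unit, whereas \<open>factors H [] u\<close> forces \<open>u\<close> to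
  be the identity.\<close>

lemma transfer_homomorphism_lift_factors:
  assumes \<theta>: "transfer_homomorphism H B \<theta>"
    and "bs \<noteq> []" "set bs \<subseteq> carrier B" "\<forall>b \<in> set bs. irreducible B b"
    and "u \<in> carrier H" "\<theta> u \<sim>\<^bsub>B\<^esub> foldr (\<otimes>\<^bsub>B\<^esub>) bs \<one>\<^bsub>B\<^esub>"
  shows "\<exists>vs. length vs = length bs \<and> set vs \<subseteq> carrier H \<and> factors H vs u"
  using assms(2-)
proof (induction bs arbitrary: u rule: list_nonempty_induct)
  case (single b)
  interpret H: comm_monoid_cancel H using \<theta> by (simp add: transfer_homomorphism_def)
  interpret B: comm_monoid_cancel B using \<theta> by (simp add: transfer_homomorphism_def)
  have "\<theta> u \<in> carrier B"
    using \<theta> single unfolding transfer_homomorphism_def hom_def by blast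
  moreover have "b \<sim>\<^bsub>B\<^esub> \<theta> u" using single calculation B.associated_sym by simp
  ultimately have "irreducible B (\<theta> u)"
    using single B.irreducible_cong by auto
  then have "irreducible H u"
    using transfer_homomorphism_irreducible_iff[OF \<theta>] single by blast
  then have "factors H [u] u" using single by (simp add: factors_def)
  then show ?case using single by (intro exI[of _ "[u]"]) auto
next
  case (cons b bs)
  interpret H: comm_monoid_cancel H using \<theta> by (simp add: transfer_homomorphism_def)
  interpret B: comm_monoid_cancel B using \<theta> by (simp add: transfer_homomorphism_def)
  have closed: "\<theta> x \<in> carrier B" if "x \<in> carrier H" for x
    using \<theta> that unfolding transfer_homomorphism_def hom_def by blast
  define p where "p = foldr (\<otimes>\<^bsub>B\<^esub>) bs \<one>\<^bsub>B\<^esub>"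
  have b: "b \<in> carrier B" and p: "p \<in> carrier B"
    using cons.prems B.multlist_closed unfolding p_def by auto
  have "\<theta> u \<sim>\<^bsub>B\<^esub> b \<otimes>\<^bsub>B\<^esub> p" using cons.prems by (simp add: p_def)
  \<comment> \<open>(T2) starts from an equation, so association is expressed by a unit
    \<open>e\<close>, which is then moved into the tail \<open>p\<close>.\<close>
  then obtain e where e: "e \<in> Units B" "\<theta> u = (b \<otimes>\<^bsub>B\<^esub> p) \<otimes>\<^bsub>B\<^esub> e"
    using B.associatedD2 b p closed cons.prems(3) by (meson B.associatedE2 B.m_closed)
  then have "\<theta> u = b \<otimes>\<^bsub>B\<^esub> (p \<otimes>\<^bsub>B\<^esub> e)" using b p e by (simp add: B.m_assoc B.Units_closed)
  moreover have pe: "p \<otimes>\<^bsub>B\<^esub> e \<in> carrier B" using p e by auto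
  ultimately obtain v w where vw: "v \<in> carrier H" "w \<in> carrier H" "u = v \<otimes>\<^bsub>H\<^esub> w"
    "\<theta> v \<sim>\<^bsub>B\<^esub> b" "\<theta> w \<sim>\<^bsub>B\<^esub> p \<otimes>\<^bsub>B\<^esub> e"
    using \<theta> cons.prems(3) b unfolding transfer_homomorphism_def by blast
  have "irreducible B (\<theta> v)"
    using B.irreducible_cong[of b "\<theta> v"] cons.prems(2) vw b closed B.associated_sym by auto
  then have v: "irreducible H v"
    using transfer_homomorphism_irreducible_iff[OF \<theta>] vw by blast
  \<comment> \<open>The unit moved into the tail is dropped again, which gives \<open>w\<close> the
    form required by the induction hypothesis.\<close>
  have "p \<otimes>\<^bsub>B\<^esub> e \<sim>\<^bsub>B\<^esub> p" using p e pe by (intro B.associatedI2[of e]) auto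
  then have "\<theta> w \<sim>\<^bsub>B\<^esub> p" using vw closed p pe B.associated_trans by blast
  then obtain vs where vs: "length vs = length bs" "set vs \<subseteq> carrier H" "factors H vs w"
    using cons.IH[of w] cons.prems vw unfolding p_def by auto
  then have "factors H (v # vs) u" using v vw by (auto simp: factors_def)
  then show ?case using vs vw by (intro exI[of _ "v # vs"]) auto
qed

text \<open>Factorizations are pushed forward by \<open>map \<theta>\<close> and pulled back by
  \<open>transfer_homomorphism_lift_factors\<close>; both keep the number of atoms. (T1) matches the
  unit case.\<close>

lemma transfer_homomorphism_length_set:
  assumes \<theta>: "transfer_homomorphism H B \<theta>" and a: "a \<in> carrier H"
  shows "length_set H a = length_set B (\<theta> a)"
proof -
  interpret H: comm_monoid_cancel H using \<theta> by (simp add: transfer_homomorphism_def)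
  interpret B: comm_monoid_cancel B using \<theta> by (simp add: transfer_homomorphism_def)
  have closed: "\<theta> x \<in> carrier B" if "x \<in> carrier H" for x
    using \<theta> that unfolding transfer_homomorphism_def hom_def by blast
  have mult: "\<theta> (x \<otimes>\<^bsub>H\<^esub> y) = \<theta> x \<otimes>\<^bsub>B\<^esub> \<theta> y" if "x \<in> carrier H" "y \<in> carrier H" for x y
    using \<theta> that unfolding transfer_homomorphism_def hom_def by blast
  have one: "\<theta> \<one>\<^bsub>H\<^esub> = \<one>\<^bsub>B\<^esub>" using \<theta> by (simp add: transfer_homomorphism_def)
  have units: "\<theta> a \<in> Units B \<longleftrightarrow> a \<in> Units H"
    using \<theta> a unfolding transfer_homomorphism_def by blast
  have foldr_map: "\<theta> (foldr (\<otimes>\<^bsub>H\<^esub>) fs \<one>\<^bsub>H\<^esub>) = foldr (\<otimes>\<^bsub>B\<^esub>) (map \<theta> fs) \<one>\<^bsub>B\<^esub>"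
    if "set fs \<subseteq> carrier H" for fs
    using that by (induction fs) (simp_all add: one mult)
  have "{length fs | fs. set fs \<subseteq> carrier H \<and> factors H fs a} =
        {length fs | fs. set fs \<subseteq> carrier B \<and> factors B fs (\<theta> a)}" if nu: "a \<notin> Units H"
  proof (intro Collect_eqI iffI)
    fix n assume "\<exists>fs. n = length fs \<and> set fs \<subseteq> carrier H \<and> factors H fs a"
    then obtain fs where fs: "n = length fs" "set fs \<subseteq> carrier H" "factors H fs a" by blast
    have "factors B (map \<theta> fs) (\<theta> a)"
      using fs(2,3) foldr_map[OF fs(2)] transfer_homomorphism_irreducible_iff[OF \<theta>]
      unfolding factors_def by auto
    then show "\<exists>fs. n = length fs \<and> set fs \<subseteq> carrier B \<and> factors B fs (\<theta> a)"
      using fs closed by (intro exI[of _ "map \<theta> fs"]) auto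
  next
    fix n assume "\<exists>fs. n = length fs \<and> set fs \<subseteq> carrier B \<and> factors B fs (\<theta> a)"
    then obtain fs where fs: "n = length fs" "set fs \<subseteq> carrier B" "factors B fs (\<theta> a)" by blast
    have "fs \<noteq> []"
    proof
      assume "fs = []"
      then have "\<theta> a = \<one>\<^bsub>B\<^esub>" using fs(3) by (simp add: factors_def)
      then show False using nu units by simp
    qed
    moreover have "\<theta> a \<sim>\<^bsub>B\<^esub> foldr (\<otimes>\<^bsub>B\<^esub>) fs \<one>\<^bsub>B\<^esub>"
      using fs(3) closed[OF a] by (simp add: factors_def)
    moreover have "\<forall>b \<in> set fs. irreducible B b" using fs(3) by (simp add: factors_def)
    ultimately show "\<exists>fs. n = length fs \<and> set fs \<subseteq> carrier H \<and> factors H fs a"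
      using transfer_homomorphism_lift_factors[OF \<theta> _ fs(2) _ a] fs(1) by metis
  qed
  then show ?thesis using units by (simp add: length_set_def)
qed

lemma length_set_associated:
  assumes "comm_monoid_cancel B" "a \<in> carrier B" "b \<in> carrier B" "a \<sim>\<^bsub>B\<^esub> b"
  shows "length_set B a = length_set B b"
proof -
  interpret B: comm_monoid_cancel B by fact
  have *: "\<exists>gs. length gs = length fs \<and> set gs \<subseteq> carrier B \<and> factors B gs y"
    if fs: "set fs \<subseteq> carrier B" "factors B fs x" and x: "x \<in> carrier B" "x \<notin> Units B"
      and y: "y \<in> carrier B" "x \<sim>\<^bsub>B\<^esub> y" for fs x y
  proof -
    obtain e where e: "e \<in> Units B" "y = x \<otimes>\<^bsub>B\<^esub> e"
      using B.associatedE2[OF B.associated_sym[OF y(2)] _ y(1) x(1)] by blast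
    \<comment> \<open>The unit \<open>e\<close> is absorbed into the first atom, so the length is
      unchanged. A first atom exists because \<open>x\<close> is not a unit.\<close>
    have "set (fs[0 := fs ! 0 \<otimes>\<^bsub>B\<^esub> e]) \<subseteq> carrier B"
      using fs(1) e(1) by (cases fs) auto
    then show ?thesis
      using B.factors_cong_unit[OF e(1) x(2) fs(2,1)] e(2)
      by (intro exI[of _ "fs[0 := fs ! 0 \<otimes>\<^bsub>B\<^esub> e]"]) simp
  qed
  have "a \<in> Units B \<longleftrightarrow> b \<in> Units B"
    using assms B.assoc_unit_r B.assoc_unit_l by blast
  then show ?thesis
    unfolding length_set_def using assms * B.associated_sym by (auto; metis)
qed

text \<open>By (T1) every element of \<open>B\<close> is associated to some
  \<open>\<theta> a\<close>, and therefore has the length set of \<open>a\<close>.\<close>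

lemma transfer_homomorphism_length_sets:
  assumes \<theta>: "transfer_homomorphism H B \<theta>"
  shows "length_set H ` carrier H = length_set B ` carrier B"
proof -
  interpret B: comm_monoid_cancel B using \<theta> by (simp add: transfer_homomorphism_def)
  have closed: "\<theta> x \<in> carrier B" if "x \<in> carrier H" for x
    using \<theta> that unfolding transfer_homomorphism_def hom_def by blast
  have "\<exists>a \<in> carrier H. length_set B b = length_set H a" if b: "b \<in> carrier B" for b
  proof -
    have "b \<in> (\<theta> ` carrier H) <#>\<^bsub>B\<^esub> Units B"
      using \<theta> b unfolding transfer_homomorphism_def by blast
    then obtain a e where a: "a \<in> carrier H" "e \<in> Units B" "b = \<theta> a \<otimes>\<^bsub>B\<^esub> e"
      unfolding set_mult_def by blast
    then have "b \<sim>\<^bsub>B\<^esub> \<theta> a" using closed by (intro B.associatedI2[of e]) auto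
    then show ?thesis
      using length_set_associated[OF B.comm_monoid_cancel_axioms b closed[OF a(1)]] a
        transfer_homomorphism_length_set[OF \<theta>] by metis
  qed
  then show ?thesis
    using closed transfer_homomorphism_length_set[OF \<theta>] by (auto simp: image_iff)
qed

section \<open>Regular elements and quotients of fractional ideals\<close>

lemma Units_subring_subset:
  assumes "cring T" "subring S T"
  shows "Units (T\<lparr>carrier := S\<rparr>) \<subseteq> Units T"
  using subringE(1)[OF assms(2)] unfolding Units_def by auto

text \<open>Units of \<open>T\<close> are cancellable, hence regular in \<open>S\<close>; the
  converse is part of \<open>total_quotient_ring\<close>. Regularity in \<open>R\<close> and in
  \<open>D\<close> thus refers to the same set \<open>Units T\<close>.\<close>

lemma regular_elements_eq:
  assumes "total_quotient_ring T S"
  shows "regular_elements (T\<lparr>carrier := S\<rparr>) = S \<inter> Units T"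
proof -
  interpret cring T using assms by (simp add: total_quotient_ring_def)
  have S: "S \<subseteq> carrier T"
    using assms subringE(1) by (auto simp: total_quotient_ring_def)
  have "b = \<zero>\<^bsub>T\<^esub>" if "a \<in> Units T" "b \<in> S" "a \<otimes>\<^bsub>T\<^esub> b = \<zero>\<^bsub>T\<^esub>" for a b
    using that S by (metis Units_closed Units_l_cancel r_null subsetD zero_closed)
  then show ?thesis
    using assms by (auto simp: regular_elements_def total_quotient_ring_def)
qed

text \<open>A unit of the ring and its inverse in \<open>S\<close> are both units of
  \<open>T\<close>, hence regular, so no inverse is lost in the monoid.\<close>

lemma Units_regular_monoid:
  assumes "total_quotient_ring T S"
  shows "Units (regular_monoid (T\<lparr>carrier := S\<rparr>)) = Units (T\<lparr>carrier := S\<rparr>)"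
proof -
  have T: "cring T" "subring S T" using assms by (auto simp: total_quotient_ring_def)
  have "x \<in> Units T \<and> y \<in> Units T"
    if "x \<in> S" "y \<in> S" "y \<otimes>\<^bsub>T\<^esub> x = \<one>\<^bsub>T\<^esub>" "x \<otimes>\<^bsub>T\<^esub> y = \<one>\<^bsub>T\<^esub>" for x y
    using that subringE(1)[OF T(2)] unfolding Units_def by auto
  then show ?thesis
    by (auto simp: Units_def regular_monoid_def regular_elements_eq[OF assms])
qed

lemma comm_monoid_cancel_regular_monoid:
  assumes "total_quotient_ring T S"
  shows "comm_monoid_cancel (regular_monoid (T\<lparr>carrier := S\<rparr>))"
proof -
  interpret cring T using assms by (simp add: total_quotient_ring_def)
  have T: "subring S T" using assms by (auto simp: total_quotient_ring_def)
  note S = subringE[OF T]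
  have car: "x \<in> carrier T" if "x \<in> Units T" for x using that by (rule Units_closed)
  show ?thesis
  proof (rule comm_monoid_cancelI)
    show "comm_monoid (regular_monoid (T\<lparr>carrier := S\<rparr>))"
      by (rule comm_monoidI)
        (simp_all add: regular_monoid_def regular_elements_eq[OF assms] S(3,6) m_ac car)
  next
    fix a b c
    assume "a \<otimes>\<^bsub>regular_monoid (T\<lparr>carrier := S\<rparr>)\<^esub> c = b \<otimes>\<^bsub>regular_monoid (T\<lparr>carrier := S\<rparr>)\<^esub> c"
      and "a \<in> carrier (regular_monoid (T\<lparr>carrier := S\<rparr>))"
        "b \<in> carrier (regular_monoid (T\<lparr>carrier := S\<rparr>))"
        "c \<in> carrier (regular_monoid (T\<lparr>carrier := S\<rparr>))"
    then show "a = b"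
      using Units_l_cancel[of c a b] m_comm[of c a] m_comm[of c b]
      by (simp add: regular_monoid_def regular_elements_eq[OF assms] car)
  qed
qed

section \<open>Colons, v-closures and maximal divisorial ideals\<close>

lemma colon_antimono: "U \<subseteq> V \<Longrightarrow> colon Q S V \<subseteq> colon Q S U"
  unfolding colon_def by blast

lemma subset_v_closure:
  assumes "comm_monoid Q" "U \<subseteq> carrier Q"
  shows "U \<subseteq> v_closure Q S U"
proof -
  interpret comm_monoid Q by fact
  show ?thesis using assms(2) by (auto simp: v_closure_def colon_def m_comm subset_iff)
qed

text \<open>The usual Galois argument: colons reverse inclusions and sets lie in their double
  colons, so a triple colon collapses to a single one.\<close>

lemma colon_v_closure:
  assumes "comm_monoid Q" "U \<subseteq> carrier Q"
  shows "colon Q S (v_closure Q S U) = colon Q S U"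
proof
  show "colon Q S (v_closure Q S U) \<subseteq> colon Q S U"
    using subset_v_closure[OF assms] by (rule colon_antimono)
  have "colon Q S U \<subseteq> carrier Q" by (auto simp: colon_def)
  then show "colon Q S U \<subseteq> colon Q S (v_closure Q S U)"
    using subset_v_closure[OF assms(1)] by (simp add: v_closure_def)
qed

lemma colon_self:
  assumes "comm_monoid Q" "submonoid S Q"
  shows "colon Q S S = S"
proof -
  interpret comm_monoid Q by fact
  interpret S: submonoid S Q by fact
  show ?thesis
  proof
    show "colon Q S S \<subseteq> S"
      using S.one_closed by (auto simp: colon_def dest!: bspec[of _ _ "\<one>\<^bsub>Q\<^esub>"])
  qed (use S.subset in \<open>auto simp: colon_def\<close>)
qed

text \<open>Two applications of antitonicity compare the double colon of \<open>U\<close> with that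
  of \<open>S\<close>, which is \<open>S\<close> by \<open>colon_self\<close>.\<close>

lemma v_closure_subset:
  assumes "comm_monoid Q" "submonoid S Q" "U \<subseteq> S"
  shows "v_closure Q S U \<subseteq> S"
proof -
  have "S \<subseteq> colon Q S U" using colon_antimono[OF assms(3), of Q S] colon_self[OF assms(1,2)] by simp
  from colon_antimono[OF this, of Q S] show ?thesis
    using colon_self[OF assms(1,2)] by (simp add: v_closure_def)
qed

text \<open>Every \<open>colon T S V\<close> is an \<open>S\<close>-submodule of \<open>T\<close>;
  this one lies in \<open>S\<close>, and the triple colon identity makes it divisorial. Allowing any
  subset \<open>U\<close> of \<open>S\<close> covers both \<open>insert x P\<close> and v-ideals of
  the monoid.\<close>

lemma divisorial_ideal_v_closure:
  assumes "cring T" "subring S T" "U \<subseteq> S"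
  shows "divisorial_ideal T S (v_closure T S U)"
proof -
  interpret cring T by fact
  note S = subringE[OF assms(2)]
  have sm: "submonoid S T" using assms(2) by (simp add: subring_def)
  define V where "V = colon T S U"
  have V: "V \<subseteq> carrier T" by (auto simp: V_def colon_def)
  have I: "v_closure T S U = colon T S V" by (simp add: v_closure_def V_def)
  have sub: "colon T S V \<subseteq> S" using v_closure_subset[OF _ sm assms(3)] I comm_monoid_axioms by simp
  have "subgroup (colon T S V) (add_monoid T)"
  proof (rule add.subgroupI)
    have "\<zero>\<^bsub>T\<^esub> \<in> colon T S V" using V S(2) by (auto simp: colon_def)
    then show "colon T S V \<noteq> {}" by blast
    show "colon T S V \<subseteq> carrier T" by (auto simp: colon_def)
    show "\<ominus>\<^bsub>T\<^esub> a \<in> colon T S V" if "a \<in> colon T S V" for a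
    proof -
      have "\<ominus>\<^bsub>T\<^esub> a \<otimes>\<^bsub>T\<^esub> y = \<ominus>\<^bsub>T\<^esub> (a \<otimes>\<^bsub>T\<^esub> y)" if "y \<in> V" for y
        using that V \<open>a \<in> colon T S V\<close> by (intro l_minus) (auto simp: colon_def)
      then show ?thesis using that S(5) by (simp add: colon_def)
    qed
    show "a \<oplus>\<^bsub>T\<^esub> b \<in> colon T S V" if "a \<in> colon T S V" "b \<in> colon T S V" for a b
    proof -
      have "(a \<oplus>\<^bsub>T\<^esub> b) \<otimes>\<^bsub>T\<^esub> y = a \<otimes>\<^bsub>T\<^esub> y \<oplus>\<^bsub>T\<^esub> b \<otimes>\<^bsub>T\<^esub> y" if "y \<in> V" for y
        using that V \<open>a \<in> _\<close> \<open>b \<in> _\<close> by (intro l_distr) (auto simp: colon_def)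
      then show ?thesis using that S(7) by (simp add: colon_def)
    qed
  qed
  then have "subgroup (colon T S V) ((add_monoid T)\<lparr>carrier := S\<rparr>)"
    using add.subgroup_incl sub subring.axioms(1)[OF assms(2)] by blast
  then have add: "subgroup (colon T S V) (add_monoid (T\<lparr>carrier := S\<rparr>))" by simp
  have l: "x \<otimes>\<^bsub>T\<^esub> a \<in> colon T S V" if "a \<in> colon T S V" "x \<in> S" for a x
    using that S V by (auto simp: colon_def m_assoc subset_iff)
  then have r: "a \<otimes>\<^bsub>T\<^esub> x \<in> colon T S V" if "a \<in> colon T S V" "x \<in> S" for a x
    using that S by (metis m_comm sub subsetD)
  have "ideal (colon T S V) (T\<lparr>carrier := S\<rparr>)"
    by (rule idealI) (use subring_is_ring[OF assms(2)] add l r in auto)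
  moreover have "v_closure T S (v_closure T S U) = v_closure T S U"
    using colon_v_closure[OF comm_monoid_axioms, of U S] assms(3) S(1)
    by (simp add: v_closure_def subset_trans)
  ultimately show ?thesis by (simp add: divisorial_ideal_def I)
qed

text \<open>The v-closure of \<open>insert x P\<close> is a divisorial ideal strictly larger than
  \<open>P\<close>, so it equals \<open>S\<close> by maximality. A set and its v-closure have the
  same colon.\<close>

lemma colon_insert_v_max:
  assumes "cring T" "subring S T" "P \<in> v_max T S" "x \<in> S" "x \<notin> P"
  shows "colon T S (insert x P) = S"
proof -
  interpret cring T by fact
  have sm: "submonoid S T" using assms(2) by (simp add: subring_def)
  note S = subringE[OF assms(2)]
  have P: "insert x P \<subseteq> S" using assms by (auto simp: v_max_def)
  then have PT: "insert x P \<subseteq> carrier T" using S(1) by blast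
  have "insert x P \<subseteq> v_closure T S (insert x P)"
    using subset_v_closure[OF comm_monoid_axioms PT] .
  moreover have "v_closure T S (insert x P) \<subseteq> S"
    using v_closure_subset[OF comm_monoid_axioms sm P] .
  ultimately have "v_closure T S (insert x P) = S"
    using assms(3,5) divisorial_ideal_v_closure[OF assms(1,2) P] unfolding v_max_def by blast
  then show ?thesis
    using colon_v_closure[OF comm_monoid_axioms PT, of S] colon_self[OF comm_monoid_axioms sm] by simp
qed


section \<open>The monoid of regular elements of a Krull ring\<close>

text \<open>If a fraction \<open>x\<close> with numerator \<open>a\<close> and denominator
  \<open>s\<close> is a unit of \<open>T\<close>, then \<open>a\<close>, being the product of
  \<open>x\<close> and \<open>s\<close>, is a unit too and hence regular.\<close>

lemma quotient_group_regular_monoid: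
  assumes "total_quotient_ring T S"
  shows "quotient_group (units_of T) (regular_monoid (T\<lparr>carrier := S\<rparr>))"
proof -
  interpret cring T using assms by (simp add: total_quotient_ring_def)
  have sub: "subring S T" using assms by (auto simp: total_quotient_ring_def)
  note S = subringE[OF sub]
  have "\<exists>a \<in> S \<inter> Units T. \<exists>b \<in> S \<inter> Units T. x = a \<otimes>\<^bsub>T\<^esub> inv\<^bsub>units_of T\<^esub> b"
    if x: "x \<in> Units T" for x
  proof -
    obtain a s where as: "a \<in> S" "s \<in> S \<inter> Units T" "x = a \<otimes>\<^bsub>T\<^esub> inv\<^bsub>T\<^esub> s"
      using assms x Units_closed regular_elements_eq[OF assms]
      unfolding total_quotient_ring_def by blast
    have "x \<otimes>\<^bsub>T\<^esub> s = a" using as S(1) by (auto simp: m_assoc subset_iff)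
    then have "a \<in> Units T" using x as(2) Units_m_closed by (metis IntD2)
    then show ?thesis using as by (auto simp: units_of_inv)
  qed
  moreover have "submonoid (S \<inter> Units T) (units_of T)"
    using S by (auto intro!: submonoid.intro simp: units_of_def)
  ultimately show ?thesis
    using units_comm_group
    by (simp add: quotient_group_def regular_monoid_def regular_elements_eq[OF assms] units_of_def)
qed

text \<open>The colon \<open>W\<close> formed in the group is contained in the colon formed in
  \<open>T\<close>. A unit in the ring closure therefore multiplies \<open>W\<close> into
  \<open>S\<close>, and the products remain units.\<close>

lemma monoid_v_ideal_v_closure_Int_Units:
  assumes "total_quotient_ring T S"
    and "monoid_v_ideal (units_of T) (regular_monoid (T\<lparr>carrier := S\<rparr>)) U"
  shows "v_closure T S U \<inter> Units T = U"
proof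
  interpret cring T using assms by (simp add: total_quotient_ring_def)
  have U: "U \<subseteq> S \<inter> Units T" "v_closure (units_of T) (S \<inter> Units T) U = U"
    using assms by (auto simp: monoid_v_ideal_def regular_monoid_def regular_elements_eq)
  show "U \<subseteq> v_closure T S U \<inter> Units T"
    using subset_v_closure[OF comm_monoid_axioms, of U S] U(1) by auto
  define W where "W = colon (units_of T) (S \<inter> Units T) U"
  have W: "W \<subseteq> Units T" "W \<subseteq> colon T S U"
    by (auto simp: W_def colon_def units_of_def Units_closed)
  show "v_closure T S U \<inter> Units T \<subseteq> U"
  proof
    fix x assume x: "x \<in> v_closure T S U \<inter> Units T"
    then have "x \<otimes>\<^bsub>T\<^esub> y \<in> S \<inter> Units T" if "y \<in> W" for y
      using W that by (auto simp: v_closure_def colon_def[of T S "colon T S U"])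
    then have "x \<in> v_closure (units_of T) (S \<inter> Units T) U"
      using x by (simp add: v_closure_def W_def[symmetric])
        (simp add: colon_def units_of_def)
    then show "x \<in> U" using U(2) by simp
  qed
qed

text \<open>Taking v-closures in \<open>T\<close> turns a chain of v-ideals of the monoid into a
  chain of ring ideals. Once that is stationary, intersecting with \<open>Units T\<close> recovers
  the original chain.\<close>

lemma Mori_monoid_regular_monoid:
  assumes "Mori_ring T S"
  shows "Mori_monoid (units_of T) (regular_monoid (T\<lparr>carrier := S\<rparr>))"
proof -
  have tq: "total_quotient_ring T S" using assms by (simp add: Mori_ring_def)
  then have T: "cring T" "subring S T" by (auto simp: total_quotient_ring_def)
  interpret cring T by fact
  let ?P = "monoid_v_ideal (units_of T) (regular_monoid (T\<lparr>carrier := S\<rparr>))"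
  have "\<exists>n. \<forall>m \<ge> n. U m = U n" if U: "\<And>n. ?P (U n)" "\<And>n. U n \<subseteq> U (Suc n)" for U
  proof (cases "\<forall>n. U n = {}")
    case False
    \<comment> \<open>The empty set can be a v-ideal of the monoid, so a chain may start with empty
      members.\<close>
    then obtain N where N: "U N \<noteq> {}" by blast
    have mono: "U i \<subseteq> U j" if "i \<le> j" for i j
      using lift_Suc_mono_le[of U] U(2) that by blast
    have sub: "U n \<subseteq> S \<inter> Units T" for n
      using U(1)[of n] by (simp add: monoid_v_ideal_def regular_monoid_def regular_elements_eq[OF tq])
    \<comment> \<open>Starting at index \<open>N\<close> puts regular elements into every
      \<open>I n\<close>, so the chain condition on regular divisorial ideals applies.\<close>
    define I where "I n = v_closure T S (U (N + n))" for n
    have div: "divisorial_ideal T S (I n)" for n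
      unfolding I_def by (rule divisorial_ideal_v_closure[OF T]) (use sub in blast)
    have "U N \<subseteq> I n" for n
      using mono[of N "N + n"] subset_v_closure[OF comm_monoid_axioms, of "U (N + n)" S] sub
      unfolding I_def by (meson Int_lower2 Units_closed le_add1 order_trans subsetI)
    then have "I n \<inter> (S \<inter> Units T) \<noteq> {}" for n using N sub by blast
    then have "regular_ideal T S (I n)" for n
      using div by (simp add: regular_ideal_def divisorial_ideal_def regular_elements_eq[OF tq])
    moreover have "I n \<subseteq> I (Suc n)" for n
      using U(2)[of "N + n"] by (simp add: I_def v_closure_def colon_antimono)
    moreover have "acc_on_sets (\<lambda>I. divisorial_ideal T S I \<and> regular_ideal T S I)"
      using assms by (simp add: Mori_ring_def)
    ultimately obtain n where n: "\<And>m. m \<ge> n \<Longrightarrow> I m = I n"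
      using div unfolding acc_on_sets_def by metis
    have rec: "I m \<inter> Units T = U (N + m)" for m
      unfolding I_def by (rule monoid_v_ideal_v_closure_Int_Units[OF tq U(1)])
    have "U m = U (N + n)" if "m \<ge> N + n" for m
      using n[of "m - N"] rec[of "m - N"] rec[of n] that by simp
    then show ?thesis by blast
  qed auto
  then show ?thesis
    using quotient_group_regular_monoid[OF tq] by (auto simp: Mori_monoid_def acc_on_sets_def)
qed

text \<open>Products and powers in \<open>units_of T\<close> are those of \<open>T\<close>, so the
  same \<open>c\<close> witnesses almost integrality over the ring.\<close>

lemma completely_integrally_closed_regular_monoid:
  assumes "completely_integrally_closed_ring T S"
  shows "completely_integrally_closed_monoid (units_of T) (regular_monoid (T\<lparr>carrier := S\<rparr>))"
proof -
  have tq: "total_quotient_ring T S"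
    using assms by (simp add: completely_integrally_closed_ring_def)
  interpret cring T using tq by (simp add: total_quotient_ring_def)
  note reg = regular_elements_eq[OF tq]
  show ?thesis
    unfolding completely_integrally_closed_monoid_def
  proof (intro conjI ballI impI)
    show "quotient_group (units_of T) (regular_monoid (T\<lparr>carrier := S\<rparr>))"
      by (rule quotient_group_regular_monoid[OF tq])
  next
    fix x
    let ?M = "carrier (regular_monoid (T\<lparr>carrier := S\<rparr>))"
    have M: "?M = S \<inter> Units T" by (simp add: regular_monoid_def reg)
    assume "x \<in> carrier (units_of T)" and
      "\<exists>c \<in> ?M. \<forall>n::nat. c \<otimes>\<^bsub>units_of T\<^esub> x [^]\<^bsub>units_of T\<^esub> n \<in> ?M"
    then obtain c where x: "x \<in> Units T" and c: "c \<in> S \<inter> Units T"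
      and "\<forall>n::nat. c \<otimes>\<^bsub>units_of T\<^esub> x [^]\<^bsub>units_of T\<^esub> n \<in> S"
      unfolding M by (auto simp: units_of_carrier)
    then have "\<forall>n::nat. c \<otimes>\<^bsub>T\<^esub> x [^]\<^bsub>T\<^esub> n \<in> S"
      by (simp add: units_of_mult units_of_pow)
    then have "almost_integral T S x"
      using c x unfolding almost_integral_def reg by blast
    then show "x \<in> ?M"
      using assms x by (simp add: completely_integrally_closed_ring_def M)
  qed
qed

lemma Krull_monoid_regular_monoid:
  "Krull_ring T S \<Longrightarrow> Krull_monoid (units_of T) (regular_monoid (T\<lparr>carrier := S\<rparr>))"
  by (simp add: Krull_ring_def Krull_monoid_def Mori_monoid_regular_monoid
    completely_integrally_closed_regular_monoid)


section \<open>The inclusion of regular monoids\<close>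

text \<open>Used with \<open>t\<close> a product of two units of \<open>D\<close>: it decides which
  of the two factors from \<open>R\<close> absorbs \<open>t\<close>.\<close>

lemma regular_factor_split:
  assumes T: "cring T" "subring D T" "subring R T" "R \<subseteq> D"
    and max: "colon T R D \<in> v_max T R"
    and r: "r \<in> R" "s \<in> R" "t \<in> D" and u: "r \<otimes>\<^bsub>T\<^esub> s \<otimes>\<^bsub>T\<^esub> t \<in> R"
  shows "r \<otimes>\<^bsub>T\<^esub> t \<in> R \<or> s \<otimes>\<^bsub>T\<^esub> t \<in> R"
proof (cases "r \<in> colon T R D")
  case True
  then show ?thesis using r by (simp add: colon_def)
next
  case False
  interpret cring T by fact
  have sub: "D \<subseteq> carrier T" using subringE(1)[OF T(2)] .
  have st: "s \<otimes>\<^bsub>T\<^esub> t \<in> D" using subringE(6)[OF T(2)] r T(4) by blast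
  have car: "r \<in> carrier T" "s \<in> carrier T" "t \<in> carrier T" using r T(4) sub by auto
  have "s \<otimes>\<^bsub>T\<^esub> t \<otimes>\<^bsub>T\<^esub> r \<in> R" using u car by (simp add: m_assoc m_comm m_lcomm)
  moreover have "s \<otimes>\<^bsub>T\<^esub> t \<otimes>\<^bsub>T\<^esub> p \<in> R" if "p \<in> colon T R D" for p
  proof -
    have "p \<in> carrier T" "p \<otimes>\<^bsub>T\<^esub> (s \<otimes>\<^bsub>T\<^esub> t) \<in> R" using that st by (auto simp: colon_def)
    then show ?thesis using car by (metis m_closed m_comm)
  qed
  \<comment> \<open>By maximality this colon is \<open>R\<close> itself, which brings the element
    from \<open>D\<close> into \<open>R\<close>.\<close>
  ultimately have "s \<otimes>\<^bsub>T\<^esub> t \<in> colon T R (insert r (colon T R D))"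
    using car by (simp add: colon_def[of T R "insert _ _"])
  then show ?thesis using colon_insert_v_max[OF T(1,3) max r(1) False] by simp
qed

text \<open>(T1) comes from the hypotheses \<open>D\<close> and \<open>units\<close>, once the
  factor from \<open>R\<close> is known to be regular; (T2) rests on
  \<open>regular_factor_split\<close>.\<close>

lemma transfer_homomorphism_regular_inclusion:
  assumes tqD: "total_quotient_ring T D" and tqR: "total_quotient_ring T R"
    and D: "D = R <#>\<^bsub>T\<^esub> Units (T\<lparr>carrier := D\<rparr>)"
    and units: "Units (T\<lparr>carrier := D\<rparr>) \<inter> R = Units (T\<lparr>carrier := R\<rparr>)"
    and max: "colon T R D \<in> v_max T R" and RD: "R \<subseteq> D"
  shows "transfer_homomorphism (regular_monoid (T\<lparr>carrier := R\<rparr>))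
           (regular_monoid (T\<lparr>carrier := D\<rparr>)) (\<lambda>x. x)"
proof -
  interpret cring T using tqD by (simp add: total_quotient_ring_def)
  have sub: "subring D T" "subring R T" using tqD tqR by (auto simp: total_quotient_ring_def)
  note S = subringE(1)[OF sub(1)]
  let ?H = "regular_monoid (T\<lparr>carrier := R\<rparr>)" and ?B = "regular_monoid (T\<lparr>carrier := D\<rparr>)"
  let ?E = "Units (T\<lparr>carrier := D\<rparr>)"
  interpret H: comm_monoid_cancel ?H by (rule comm_monoid_cancel_regular_monoid[OF tqR])
  interpret B: comm_monoid_cancel ?B by (rule comm_monoid_cancel_regular_monoid[OF tqD])
  have car: "carrier ?H = R \<inter> Units T" "carrier ?B = D \<inter> Units T"
    using regular_elements_eq[OF tqR] regular_elements_eq[OF tqD] by (auto simp: regular_monoid_def)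
  have ops [simp]: "x \<otimes>\<^bsub>?H\<^esub> y = x \<otimes>\<^bsub>T\<^esub> y" "x \<otimes>\<^bsub>?B\<^esub> y = x \<otimes>\<^bsub>T\<^esub> y"
    "\<one>\<^bsub>?H\<^esub> = \<one>\<^bsub>T\<^esub>" "\<one>\<^bsub>?B\<^esub> = \<one>\<^bsub>T\<^esub>" for x y
    by (auto simp: regular_monoid_def)
  note UH = Units_regular_monoid[OF tqR] and UB = Units_regular_monoid[OF tqD]
  have E: "?E \<subseteq> Units T" "?E \<subseteq> D"
    using Units_subring_subset[OF is_cring sub(1)] by (auto simp: Units_def)
  have mult_E: "x \<otimes>\<^bsub>T\<^esub> y \<in> ?E" if "x \<in> ?E" "y \<in> ?E" for x y
    using B.Units_m_closed that unfolding UB by simp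
  \<comment> \<open>A divisor of a unit is a unit; hence the factor from \<open>R\<close> of a
    regular element of \<open>D\<close> is regular.\<close>
  have cancel: "a \<in> Units T" if "a \<in> carrier T" "b \<in> carrier T" "a \<otimes>\<^bsub>T\<^esub> b \<in> Units T" for a b
    using that unit_factor by blast
  have decomp: "\<exists>r \<in> R \<inter> Units T. \<exists>e \<in> ?E. b = r \<otimes>\<^bsub>T\<^esub> e" if b: "b \<in> D \<inter> Units T" for b
  proof -
    obtain r e where re: "r \<in> R" "e \<in> ?E" "b = r \<otimes>\<^bsub>T\<^esub> e"
      using b D unfolding set_mult_def by blast
    then have "r \<in> Units T" using b cancel[of r e] RD S E by blast
    then show ?thesis using re by blast
  qed
  have T2: "\<exists>v \<in> R \<inter> Units T. \<exists>w \<in> R \<inter> Units T. u = v \<otimes>\<^bsub>T\<^esub> w \<and> v \<sim>\<^bsub>?B\<^esub> b \<and> w \<sim>\<^bsub>?B\<^esub> c"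
    if u: "u \<in> R \<inter> Units T" and b: "b \<in> D \<inter> Units T" and c: "c \<in> D \<inter> Units T"
      and eq: "u = b \<otimes>\<^bsub>T\<^esub> c" for u b c
  proof -
    obtain r e where re: "r \<in> R \<inter> Units T" "e \<in> ?E" "b = r \<otimes>\<^bsub>T\<^esub> e" using decomp[OF b] by blast
    obtain s h where sh: "s \<in> R \<inter> Units T" "h \<in> ?E" "c = s \<otimes>\<^bsub>T\<^esub> h" using decomp[OF c] by blast
    \<comment> \<open>The unit parts of \<open>b\<close> and \<open>c\<close> are pooled so that a
      single factor can take both.\<close>
    define t where "t = e \<otimes>\<^bsub>T\<^esub> h"
    have t: "t \<in> ?E" using re sh mult_E by (simp add: t_def)
    have cl: "r \<in> carrier T" "e \<in> carrier T" "s \<in> carrier T" "h \<in> carrier T" "t \<in> carrier T"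
      using re sh t E by auto
    have u_eq: "u = r \<otimes>\<^bsub>T\<^esub> s \<otimes>\<^bsub>T\<^esub> t"
      using eq re sh cl by (simp add: t_def m_assoc m_lcomm)
    \<comment> \<open>Changing the unit part preserves the class in \<open>D\<close>. The factor
      that absorbs \<open>t\<close> is compared with unit part \<open>t\<close>, the other one with
      unit part \<open>\<one>\<close>.\<close>
    have assoc: "x \<otimes>\<^bsub>T\<^esub> f \<sim>\<^bsub>?B\<^esub> x \<otimes>\<^bsub>T\<^esub> g"
      if x: "x \<in> R \<inter> Units T" and f: "f \<in> ?E" and g: "g \<in> ?E" for x f g
    proof -
      have x': "x \<in> carrier ?B" using x RD car by blast
      have "x \<otimes>\<^bsub>?B\<^esub> f \<sim>\<^bsub>?B\<^esub> x" "x \<otimes>\<^bsub>?B\<^esub> g \<sim>\<^bsub>?B\<^esub> x"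
        using B.associatedI2[of f _ x] B.associatedI2[of g _ x] x' f g unfolding UB by blast+
      moreover have "x \<otimes>\<^bsub>?B\<^esub> f \<in> carrier ?B" "x \<otimes>\<^bsub>?B\<^esub> g \<in> carrier ?B"
        using x' f g B.Units_closed unfolding UB by blast+
      ultimately have "x \<otimes>\<^bsub>?B\<^esub> f \<sim>\<^bsub>?B\<^esub> x \<otimes>\<^bsub>?B\<^esub> g"
        using x' B.associated_sym B.associated_trans by blast
      then show ?thesis by simp
    qed
    have one: "\<one>\<^bsub>T\<^esub> \<in> ?E" using B.Units_one_closed unfolding UB by simp
    have u1: "u = (r \<otimes>\<^bsub>T\<^esub> t) \<otimes>\<^bsub>T\<^esub> s" "u = r \<otimes>\<^bsub>T\<^esub> (s \<otimes>\<^bsub>T\<^esub> t)"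
      using u_eq cl by (simp_all add: m_assoc m_comm m_lcomm)
    have un: "r \<otimes>\<^bsub>T\<^esub> t \<in> Units T" "s \<otimes>\<^bsub>T\<^esub> t \<in> Units T" using re sh t E by auto
    have "r \<otimes>\<^bsub>T\<^esub> t \<in> R \<or> s \<otimes>\<^bsub>T\<^esub> t \<in> R"
      using regular_factor_split[OF is_cring sub RD max, of r s t] re sh t E u u_eq by blast
    then show ?thesis
    proof
      assume "r \<otimes>\<^bsub>T\<^esub> t \<in> R"
      moreover have "r \<otimes>\<^bsub>T\<^esub> t \<sim>\<^bsub>?B\<^esub> b" "s \<sim>\<^bsub>?B\<^esub> c"
        using assoc[OF re(1) t re(2)] assoc[OF sh(1) one sh(2)] re sh cl by simp_all
      ultimately show ?thesis using u1(1) un sh(1) by blast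
    next
      assume "s \<otimes>\<^bsub>T\<^esub> t \<in> R"
      moreover have "s \<otimes>\<^bsub>T\<^esub> t \<sim>\<^bsub>?B\<^esub> c" "r \<sim>\<^bsub>?B\<^esub> b"
        using assoc[OF sh(1) t sh(2)] assoc[OF re(1) one re(2)] re sh cl by simp_all
      ultimately show ?thesis using u1(2) un re(1) by blast
    qed
  qed
  have "carrier ?B = carrier ?H <#>\<^bsub>?B\<^esub> Units ?B"
  proof
    show "carrier ?B \<subseteq> carrier ?H <#>\<^bsub>?B\<^esub> Units ?B"
      using decomp by (auto simp: car UB set_mult_def)
    show "carrier ?H <#>\<^bsub>?B\<^esub> Units ?B \<subseteq> carrier ?B"
      using B.set_mult_closed[of "carrier ?H" "Units ?B"] RD B.Units_closed by (auto simp: car)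
  qed
  moreover have "{u \<in> carrier ?H. u \<in> Units ?B} = Units ?H"
    using units E by (auto simp: car UH UB)
  moreover have "(\<lambda>x. x) \<in> hom ?H ?B" using RD by (auto simp: hom_def car)
  moreover have "\<forall>u \<in> carrier ?H. \<forall>b \<in> carrier ?B. \<forall>c \<in> carrier ?B. u = b \<otimes>\<^bsub>?B\<^esub> c \<longrightarrow>
      (\<exists>v \<in> carrier ?H. \<exists>w \<in> carrier ?H. u = v \<otimes>\<^bsub>?H\<^esub> w \<and> v \<sim>\<^bsub>?B\<^esub> b \<and> w \<sim>\<^bsub>?B\<^esub> c)"
    unfolding car ops by (intro ballI impI) (rule T2)
  ultimately show ?thesis
    unfolding transfer_homomorphism_def image_ident
    using H.comm_monoid_cancel_axioms B.comm_monoid_cancel_axioms by (intro conjI) simp_all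
qed

theorem theorem4p5:
  fixes T :: "('a, 'b) ring_scheme" and D R :: "'a set"
  assumes "total_quotient_ring T D"
    and "subring R (T\<lparr>carrier := D\<rparr>)"
    and "total_quotient_ring T R"
    and "D = R <#>\<^bsub>T\<^esub> Units (T\<lparr>carrier := D\<rparr>)"
    and "Units (T\<lparr>carrier := D\<rparr>) \<inter> R = Units (T\<lparr>carrier := R\<rparr>)"
    and "colon T R D \<in> v_max T R"
  shows "(Krull_ring T D \<longrightarrow>
            Krull_monoid (units_of T) (regular_monoid (T\<lparr>carrier := D\<rparr>)) \<and>
            transfer_homomorphism (regular_monoid (T\<lparr>carrier := R\<rparr>))
              (regular_monoid (T\<lparr>carrier := D\<rparr>)) (\<lambda>x. x) \<and>
            system_of_length_sets (T\<lparr>carrier := R\<rparr>) = system_of_length_sets (T\<lparr>carrier := D\<rparr>)) \<and>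
         (C_ring TYPE('f) (T\<lparr>carrier := D\<rparr>) \<longrightarrow>
            C_monoid TYPE('f) (regular_monoid (T\<lparr>carrier := D\<rparr>)) \<and>
            transfer_homomorphism (regular_monoid (T\<lparr>carrier := R\<rparr>))
              (regular_monoid (T\<lparr>carrier := D\<rparr>)) (\<lambda>x. x) \<and>
            system_of_length_sets (T\<lparr>carrier := R\<rparr>) = system_of_length_sets (T\<lparr>carrier := D\<rparr>))"
proof -
  have R: "R \<subseteq> D" using subringE(1)[OF assms(2)] by simp
  note transfer = transfer_homomorphism_regular_inclusion[OF assms(1,3-6) R]
  have "system_of_length_sets (T\<lparr>carrier := R\<rparr>) = system_of_length_sets (T\<lparr>carrier := D\<rparr>)"
    using transfer_homomorphism_length_sets[OF transfer]
    by (simp add: system_of_length_sets_def regular_monoid_def)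
  \<comment> \<open>The transfer property and the equality of length systems serve both parts; the
    C-monoid claim is the definition of a C-ring.\<close>
  then show ?thesis
    using transfer by (simp add: Krull_monoid_regular_monoid C_ring_def)
qed

end
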